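(* Let $A$ be a $C^*$-algebra. Then an element $a\in A$ is a normal Moore-Penrose hermitian element if and only if $a$ is a hermitian partial isometry.
   Context: An element $a$ of a $C^*$-algebra $A$ is called regular if there is $a'\in A$ with $a = aa'a$. Every regular element $a$ of a $C^*$-algebra has a unique Moore-Penrose inverse, denoted $a^{\dagger}$: the unique $x\in A$ with $a=axa$, $x=xax$, $(ax)^*=ax$, $(xa)^*=xa$. An element $a\in A$ is called Moore-Penrose hermitian if it is regular and $a^{\dagger}=a$. An element $a\in A$ is called a partial isometry if it is regular and $a^{\dagger}=a^*$. Hermitian means $a^*=a$, and normal means $aa^*=a^*a$. *)

theory Defs
  imports Complex_Main
begin

text \<open>
  C*-algebras, not assumed unital. The distribution has no class of complex algebras, so the complex
  scalar multiplication is added on top of the real Banach algebra structure, which it extends.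
\<close>

class cstar_algebra = real_normed_algebra + banach +
  fixes scaleC :: "complex \<Rightarrow> 'a \<Rightarrow> 'a"  (infixr \<open>*\<^sub>C\<close> 75)
    and star :: "'a \<Rightarrow> 'a"  (\<open>_\<^sup>\<star>\<close> [1000] 999)
  assumes scaleR_scaleC: "r *\<^sub>R x = complex_of_real r *\<^sub>C x"
    and scaleC_add_right: "c *\<^sub>C (x + y) = c *\<^sub>C x + c *\<^sub>C y"
    and scaleC_add_left: "(c + d) *\<^sub>C x = c *\<^sub>C x + d *\<^sub>C x"
    and scaleC_scaleC: "c *\<^sub>C (d *\<^sub>C x) = (c * d) *\<^sub>C x"
    and scaleC_one: "1 *\<^sub>C x = x"
    and mult_scaleC_left: "(c *\<^sub>C x) * y = c *\<^sub>C (x * y)"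
    and mult_scaleC_right: "x * (c *\<^sub>C y) = c *\<^sub>C (x * y)"
    and norm_scaleC: "norm (c *\<^sub>C x) = cmod c * norm x"
    and star_star: "(x\<^sup>\<star>)\<^sup>\<star> = x"
    and star_add: "(x + y)\<^sup>\<star> = x\<^sup>\<star> + y\<^sup>\<star>"
    and star_scaleC: "(c *\<^sub>C x)\<^sup>\<star> = cnj c *\<^sub>C x\<^sup>\<star>"
    and star_mult: "(x * y)\<^sup>\<star> = y\<^sup>\<star> * x\<^sup>\<star>"
    and cstar_identity: "norm (x\<^sup>\<star> * x) = (norm x)\<^sup>2"

definition regular :: "'a::cstar_algebra \<Rightarrow> bool" where
  "regular a \<longleftrightarrow> (\<exists>a'. a = a * a' * a)"

text \<open>
  By uniqueness of the Moore-Penrose inverse, which exists for every regular element of a C*-algebra,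
  the description below is proper on regular elements; for other elements its value is unspecified.
\<close>

definition mp_inverse :: "'a::cstar_algebra \<Rightarrow> 'a"  (\<open>_\<^sup>\<dagger>\<close> [1000] 999) where
  "a\<^sup>\<dagger> = (THE x. a = a * x * a \<and> x = x * a * x \<and> (a * x)\<^sup>\<star> = a * x \<and> (x * a)\<^sup>\<star> = x * a)"

definition mp_hermitian :: "'a::cstar_algebra \<Rightarrow> bool" where
  "mp_hermitian a \<longleftrightarrow> regular a \<and> a\<^sup>\<dagger> = a"

definition partial_isometry :: "'a::cstar_algebra \<Rightarrow> bool" where
  "partial_isometry a \<longleftrightarrow> regular a \<and> a\<^sup>\<dagger> = a\<^sup>\<star>"

definition hermitian :: "'a::cstar_algebra \<Rightarrow> bool" where
  "hermitian a \<longleftrightarrow> a\<^sup>\<star> = a"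

definition normal :: "'a::cstar_algebra \<Rightarrow> bool" where
  "normal a \<longleftrightarrow> a * a\<^sup>\<star> = a\<^sup>\<star> * a"

end

theory Submission
  imports Defs "HOL-Analysis.Elementary_Metric_Spaces"
begin

text \<open>
  A normal Moore-Penrose hermitian \<open>a\<close> satisfies \<open>a\<^sup>3 = a\<close>, so its spectrum lies in
  \<open>{-1, 0, 1}\<close>; a normal element with real spectrum is hermitian. The same conclusion follows
  without functional calculus. Put \<open>u = (a - a\<^sup>\<star>) / 2\<close>. Since \<open>a\<^sup>2\<close> is
  hermitian, a computation with commuting elements gives \<open>u\<^sup>4 = u\<^sup>2\<close>, that is, \<open>1 - u\<^sup>2\<close>
  annihilates \<open>u\<^sup>2\<close>. But \<open>u\<close> is skew-hermitian, so \<open>1 - u\<^sup>2\<close> is one plus the square of the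
  hermitian element \<open>i u\<close> and is injective (\<open>skew_resolvent_square_inj\<close>). Hence
  \<open>u\<^sup>2 = 0\<close>, and the \<open>C\<^sup>*\<close>-identity forces \<open>u = 0\<close>. The converse only replaces \<open>a\<^sup>\<star>\<close> by \<open>a\<close>.

  The delicate point is that \<open>a\<^sup>\<dagger> = a\<close> yields the Penrose equations for \<open>a\<close> only if a Moore-Penrose
  inverse exists, the symbol being a definite description. So existence for every regular element
  (\<open>regular_imp_ex1_penrose\<close>) has to be proved. If \<open>a = a b a\<close>, the idempotents \<open>a b\<close> and \<open>b a\<close>
  are replaced by projections with the same range and the same kernel, respectively; these
  become \<open>a a\<^sup>\<dagger>\<close> and \<open>a\<^sup>\<dagger> a\<close>. The projection belonging to an idempotent \<open>e\<close> is
  \<open>e e\<^sup>\<star> (1 - u\<^sup>2)\<^sup>-\<^sup>1\<close> with \<open>u = e - e\<^sup>\<star>\<close>. Since the algebra need not have a unit, \<open>1 - u\<^sup>2\<close> is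
  treated as the operator \<open>x \<mapsto> x - u (u x)\<close> on the algebra. It factors as \<open>(1 + u) (1 - u)\<close>, and
  \<open>1 + u\<close> is bijective because the spectrum of a skew-hermitian element is purely imaginary; the
  contraction in \<open>skew_add_surj\<close> contains the estimate behind that fact.
\<close>

section \<open>The involution\<close>

lemma star_scaleR: "(r *\<^sub>R x)\<^sup>\<star> = r *\<^sub>R (x::'a::cstar_algebra)\<^sup>\<star>"
  by (simp add: scaleR_scaleC star_scaleC)

lemma star_minus: "(- x)\<^sup>\<star> = - (x::'a::cstar_algebra)\<^sup>\<star>"
  using star_scaleR[of "-1" x] by simp

lemma star_diff: "(x - y)\<^sup>\<star> = x\<^sup>\<star> - (y::'a::cstar_algebra)\<^sup>\<star>"
  using star_add[of x "- y"] by (simp add: star_minus)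

lemma star_mult_self_eq_zero_iff: "x\<^sup>\<star> * x = 0 \<longleftrightarrow> x = (0::'a::cstar_algebra)"
  using cstar_identity[of x] by auto

section \<open>Skew-hermitian perturbations of the identity\<close>

lemma skew_add_inj:
  fixes u x :: "'a::cstar_algebra"
  assumes skew: "u\<^sup>\<star> = - u" and eq: "x + u * x = 0"
  shows "x = 0"
proof -
  have ux: "u * x = - x" using eq by (simp add: add_eq_0_iff)
  \<comment> \<open>The skew-hermitian element \<open>x\<^sup>\<star> u x\<close> equals the hermitian element \<open>- x\<^sup>\<star> x\<close>.\<close>
  have "x\<^sup>\<star> * (u * x) = - (x\<^sup>\<star> * x)" by (simp add: ux)
  moreover have "x\<^sup>\<star> * (u * x) = x\<^sup>\<star> * x"
  proof -
    have "x\<^sup>\<star> * (u * x) = - ((u * x)\<^sup>\<star> * x)" by (simp add: star_mult skew mult.assoc)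
    then show ?thesis by (simp add: ux star_minus)
  qed
  ultimately have "x\<^sup>\<star> * x = - (x\<^sup>\<star> * x)" by simp
  then have "x\<^sup>\<star> * x + x\<^sup>\<star> * x = 0" by (simp only: eq_neg_iff_add_eq_0)
  then have "2 *\<^sub>R (x\<^sup>\<star> * x) = 0" by (simp only: scaleR_2)
  then show ?thesis by (simp add: star_mult_self_eq_zero_iff)
qed

text \<open>
  In \<open>(t x - u x)\<^sup>\<star> (t x - u x)\<close> the mixed terms cancel. The bound therefore grows like
  \<open>t + O(1/t)\<close> instead of \<open>t + \<parallel>u\<parallel>\<close>, and lies below \<open>t + 1\<close> for large \<open>t\<close>.
\<close>

lemma norm_scaleR_diff_skew_le:
  fixes u x :: "'a::cstar_algebra"
  assumes skew: "u\<^sup>\<star> = - u"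
  shows "(norm (t *\<^sub>R x - u * x))\<^sup>2 \<le> (t\<^sup>2 + (norm u)\<^sup>2) * (norm x)\<^sup>2"
proof -
  have "(t *\<^sub>R x - u * x)\<^sup>\<star> * (t *\<^sub>R x - u * x)
      = t\<^sup>2 *\<^sub>R (x\<^sup>\<star> * x) + (u * x)\<^sup>\<star> * (u * x)"
    by (simp add: star_diff star_scaleR star_mult skew algebra_simps power2_eq_square)
  then have "(norm (t *\<^sub>R x - u * x))\<^sup>2
      = norm (t\<^sup>2 *\<^sub>R (x\<^sup>\<star> * x) + (u * x)\<^sup>\<star> * (u * x))"
    by (metis cstar_identity)
  also have "\<dots> \<le> t\<^sup>2 * (norm x)\<^sup>2 + (norm (u * x))\<^sup>2"
    by (rule norm_triangle_le) (simp add: cstar_identity)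
  also have "\<dots> \<le> t\<^sup>2 * (norm x)\<^sup>2 + (norm u * norm x)\<^sup>2"
    by (intro add_left_mono power_mono norm_mult_ineq) simp
  finally show ?thesis by (simp add: algebra_simps power_mult_distrib)
qed

text \<open>
  The equation \<open>x + u x = y\<close> says that \<open>x\<close> is a fixed point of
  \<open>x \<mapsto> (y + (t x - u x)) / (1 + t)\<close>, which is a contraction for large \<open>t\<close>.
\<close>

lemma skew_add_surj:
  fixes u y :: "'a::cstar_algebra"
  assumes skew: "u\<^sup>\<star> = - u"
  shows "\<exists>x. x + u * x = y"
proof -
  \<comment> \<open>For this \<open>t\<close> the bound \<open>t\<^sup>2 + \<parallel>u\<parallel>\<^sup>2\<close> is \<open>t (1 + t)\<close>, so the Lipschitz constant is
    the square root of \<open>t / (1 + t)\<close>.\<close>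
  define t where "t = (norm u)\<^sup>2"
  define c where "c = sqrt (t / (1 + t))"
  define f where "f x = (1 / (1 + t)) *\<^sub>R (y + (t *\<^sub>R x - u * x))" for x
  have t: "t \<ge> 0" by (simp add: t_def)
  have c: "0 \<le> c" "c < 1" using t by (simp_all add: c_def)
  have c2: "t\<^sup>2 + (norm u)\<^sup>2 = (c * (1 + t))\<^sup>2"
  proof -
    have "c\<^sup>2 = t / (1 + t)" using t by (simp add: c_def)
    then have "(c * (1 + t))\<^sup>2 = t / (1 + t) * (1 + t)\<^sup>2"
      by (simp only: power_mult_distrib)
    also have "\<dots> = t * (1 + t)" using t by (simp add: power2_eq_square)
    also have "\<dots> = t\<^sup>2 + (norm u)\<^sup>2"
      unfolding t_def[symmetric] by (simp add: power2_eq_square algebra_simps)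
    finally show ?thesis ..
  qed
  have bound: "norm (t *\<^sub>R z - u * z) \<le> c * (1 + t) * norm z" for z
  proof (rule power2_le_imp_le)
    show "(norm (t *\<^sub>R z - u * z))\<^sup>2 \<le> (c * (1 + t) * norm z)\<^sup>2"
      using norm_scaleR_diff_skew_le[OF skew, of t z] by (simp add: c2 power_mult_distrib)
  qed (use c t in simp)
  have lipschitz: "dist (f v) (f w) \<le> c * dist v w" for v w
  proof -
    have "f v - f w = (1 / (1 + t)) *\<^sub>R (t *\<^sub>R (v - w) - u * (v - w))"
      unfolding f_def by (simp add: algebra_simps)
    then have "norm (f v - f w) = norm (t *\<^sub>R (v - w) - u * (v - w)) / (1 + t)"
      using t by simp
    also have "\<dots> \<le> c * (1 + t) * norm (v - w) / (1 + t)"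
      by (rule divide_right_mono[OF bound]) (use t in simp)
    also have "\<dots> = c * norm (v - w)" using t by simp
    finally show ?thesis by (simp add: dist_norm)
  qed
  obtain x where "f x = x"
    using banach_fix_type[OF c] lipschitz by blast
  then have "(1 + t) *\<^sub>R f x = (1 + t) *\<^sub>R x" by simp
  then have "y + (t *\<^sub>R x - u * x) = (1 + t) *\<^sub>R x" using t by (simp add: f_def)
  then have "x + u * x = y" by (simp add: algebra_simps)
  then show ?thesis ..
qed

lemma skew_resolvent_square_inj:
  fixes u x :: "'a::cstar_algebra"
  assumes skew: "u\<^sup>\<star> = - u" and eq: "x - u * (u * x) = 0"
  shows "x = 0"
proof -
  have "(x - u * x) + u * (x - u * x) = 0" using eq by (simp add: algebra_simps)
  then have "x - u * x = 0" by (rule skew_add_inj[OF skew])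
  then have "x + (- u) * x = 0" by simp
  then show ?thesis by (rule skew_add_inj[rotated]) (simp add: star_minus skew)
qed

lemma skew_resolvent_square_surj:
  fixes u y :: "'a::cstar_algebra"
  assumes skew: "u\<^sup>\<star> = - u"
  shows "\<exists>x. x - u * (u * x) = y"
proof -
  obtain z where z: "z + u * z = y" using skew_add_surj[OF skew] by blast
  have "(- u)\<^sup>\<star> = - (- u)" by (simp add: star_minus skew)
  then obtain x where x: "x + (- u) * x = z" using skew_add_surj by blast
  have "x - u * (u * x) = y" unfolding z[symmetric] x[symmetric] by (simp add: algebra_simps)
  then show ?thesis ..
qed

section \<open>Existence and uniqueness of the Moore-Penrose inverse\<close>

text \<open>
  The solution of \<open>(1 - u\<^sup>2) p = e e\<^sup>\<star>\<close> works: \<open>1 - u\<^sup>2\<close> commutes with \<open>e\<close> and \<open>e\<^sup>\<star>\<close>, and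
  \<open>(1 - u\<^sup>2) e = e e\<^sup>\<star> e\<close>. All properties of \<open>p\<close> then follow by cancelling the injective operator
  \<open>1 - u\<^sup>2\<close>.
\<close>

lemma idempotent_range_projection:
  fixes e :: "'a::cstar_algebra"
  assumes idem: "e * e = e"
  shows "\<exists>p. p\<^sup>\<star> = p \<and> p * e = e \<and> e * p = p"
proof -
  define u where "u = e - e\<^sup>\<star>"
  define K where "K x = x - u * (u * x)" for x
  have skew: "u\<^sup>\<star> = - u" by (simp add: u_def star_diff star_star)
  have idem_star: "e\<^sup>\<star> * e\<^sup>\<star> = e\<^sup>\<star>" using idem by (metis star_mult)
  have idem': "e * (e * x) = e * x" "e\<^sup>\<star> * (e\<^sup>\<star> * x) = e\<^sup>\<star> * x" for x
    by (simp_all add: mult.assoc[symmetric] idem idem_star)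
  have inj: "x = y" if "K x = K y" for x y
    using skew_resolvent_square_inj[OF skew, of "x - y"] that by (simp add: K_def algebra_simps)
  have K_eq: "K x = x + e * (e\<^sup>\<star> * x) + e\<^sup>\<star> * (e * x) - e * x - e\<^sup>\<star> * x" for x
    by (simp add: K_def u_def idem' algebra_simps)
  have K_e: "K (e * x) = e * (e\<^sup>\<star> * (e * x))" for x
    by (simp add: K_eq idem')
  have e_K: "e * K x = K (e * x)" for x
    by (simp add: K_eq idem' algebra_simps)
  have K_mult: "K (x * y) = K x * y" for x y
    by (simp add: K_def algebra_simps)
  obtain p where p: "K p = e * e\<^sup>\<star>"
    using skew_resolvent_square_surj[OF skew] by (auto simp: K_def)
  have ep: "e * p = p"
    by (rule inj) (simp add: e_K[symmetric] p idem')
  have pe: "p * e = e"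
    by (rule inj) (use K_e[of e] in \<open>simp add: K_mult p idem mult.assoc\<close>)
  \<comment> \<open>Right multiplication by \<open>1 - u\<^sup>2\<close> is the adjoint of \<open>K\<close>. Since \<open>e e\<^sup>\<star>\<close> commutes with \<open>1 - u\<^sup>2\<close>,
    so does \<open>p\<close>; hence \<open>K (p\<^sup>\<star>)\<close> is the adjoint of \<open>p (1 - u\<^sup>2) = (1 - u\<^sup>2) p = e e\<^sup>\<star>\<close>.\<close>
  have star_K: "(K x)\<^sup>\<star> = x\<^sup>\<star> - x\<^sup>\<star> * u * u" for x
    by (simp add: K_def star_diff star_mult skew mult.assoc)
  have commute: "p - p * u * u = K p"
  proof (rule inj)
    have "K (p - p * u * u) = K p - K p * u * u"
      by (simp add: K_def algebra_simps)
    also have "\<dots> = (K (e * e\<^sup>\<star>))\<^sup>\<star>"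
      by (simp add: p star_K star_mult star_star)
    also have "\<dots> = K (e * e\<^sup>\<star>)"
      by (simp add: K_e star_mult star_star mult.assoc)
    finally show "K (p - p * u * u) = K (K p)" by (simp add: p)
  qed
  have "p\<^sup>\<star> = p"
  proof (rule inj)
    have "K (p\<^sup>\<star>) = (p - p * u * u)\<^sup>\<star>"
      by (simp add: K_def star_diff star_mult skew mult.assoc)
    then show "K (p\<^sup>\<star>) = K p" by (simp add: commute p star_mult star_star)
  qed
  with ep pe show ?thesis by blast
qed

definition penrose :: "'a::cstar_algebra \<Rightarrow> 'a \<Rightarrow> bool" where
  "penrose a x \<longleftrightarrow> a = a * x * a \<and> x = x * a * x \<and> (a * x)\<^sup>\<star> = a * x \<and> (x * a)\<^sup>\<star> = x * a"

text \<open>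
  For projections \<open>p\<close> onto the range of \<open>a b\<close> and \<open>q\<close> along the kernel of \<open>b a\<close>, the element
  \<open>q b p\<close> is the inverse of \<open>a\<close> between the ranges of \<open>q\<close> and \<open>p\<close>.
\<close>

lemma regular_imp_ex_penrose:
  fixes a :: "'a::cstar_algebra"
  assumes "regular a"
  shows "\<exists>x. penrose a x"
proof -
  obtain b where b: "a * b * a = a" using assms unfolding regular_def by metis
  have "(a * b) * (a * b) = a * b" by (metis b mult.assoc)
  then obtain p where p: "p\<^sup>\<star> = p" "p * (a * b) = a * b" "(a * b) * p = p"
    using idempotent_range_projection by blast
  \<comment> \<open>Passing to adjoints exchanges range and kernel.\<close>
  have "(b * a)\<^sup>\<star> * (b * a)\<^sup>\<star> = (b * a)\<^sup>\<star>" by (metis b mult.assoc star_mult)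
  then obtain q where q: "q\<^sup>\<star> = q" "q * (b * a)\<^sup>\<star> = (b * a)\<^sup>\<star>" "(b * a)\<^sup>\<star> * q = q"
    using idempotent_range_projection by blast
  have q': "b * a * q = b * a" "q * (b * a) = q"
    using q by (metis star_mult star_star)+
  have pa: "p * a = a" by (metis b mult.assoc p(2))
  have aq: "a * q = a" by (metis b mult.assoc q'(1))
  define x where "x = q * b * p"
  have ax: "a * x = p"
  proof -
    have "a * x = a * q * b * p" by (simp add: x_def mult.assoc)
    then show ?thesis by (simp add: aq p)
  qed
  have xa: "x * a = q"
    unfolding x_def using pa q'(2) by (simp add: mult.assoc)
  have "q * q = q" using aq q'(2) by (metis mult.assoc)
  then have "q * x = x" unfolding x_def by (simp add: mult.assoc[symmetric])
  then have "penrose a x" by (simp add: penrose_def ax xa pa p q)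
  then show ?thesis ..
qed

lemma penrose_unique:
  fixes a x y :: "'a::cstar_algebra"
  assumes "penrose a x" "penrose a y"
  shows "x = y"
proof -
  have x: "a * x * a = a" "x * a * x = x" "(a * x)\<^sup>\<star> = a * x" "(x * a)\<^sup>\<star> = x * a"
    and y: "a * y * a = a" "y * a * y = y" "(a * y)\<^sup>\<star> = a * y" "(y * a)\<^sup>\<star> = y * a"
    using assms unfolding penrose_def by metis+
  \<comment> \<open>Projections with the same range, or with the same kernel, coincide.\<close>
  have "a * x = (a * y) * (a * x)" by (metis y(1) mult.assoc)
  then have "a * x = (a * x) * (a * y)" by (metis star_mult x(3) y(3))
  then have ax: "a * x = a * y" by (metis x(1) mult.assoc)
  have "x * a = (x * a) * (y * a)" by (metis y(1) mult.assoc)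
  then have "x * a = (y * a) * (x * a)" by (metis star_mult x(4) y(4))
  then have xa: "x * a = y * a" by (metis x(1) mult.assoc)
  show ?thesis by (metis ax xa x(2) y(2) mult.assoc)
qed

lemma regular_imp_ex1_penrose:
  assumes "regular a"
  shows "\<exists>!x. penrose a x"
  using regular_imp_ex_penrose[OF assms] penrose_unique by blast

lemma penrose_mp_inverse:
  assumes "regular a"
  shows "penrose a (a\<^sup>\<dagger>)"
  using theI'[OF regular_imp_ex1_penrose[OF assms]] unfolding mp_inverse_def penrose_def .

section \<open>Normal Moore-Penrose hermitian elements\<close>

lemma normal_mp_hermitian_imp_hermitian:
  fixes a :: "'a::cstar_algebra"
  assumes "normal a" and "mp_hermitian a"
  shows "hermitian a"
proof -
  have "penrose a a"
    using penrose_mp_inverse[of a] assms(2) by (simp add: mp_hermitian_def)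
  then have aaa: "a * (a * a) = a" and aa: "a\<^sup>\<star> * a\<^sup>\<star> = a * a"
    unfolding penrose_def by (simp_all add: star_mult mult.assoc)
  have comm: "a\<^sup>\<star> * a = a * a\<^sup>\<star>" using assms(1) by (simp add: normal_def)
  \<comment> \<open>Both \<open>a a\<close> and \<open>a a\<^sup>\<star>\<close> square to \<open>a a\<close>, which is a unit for \<open>a\<close> and \<open>a\<^sup>\<star>\<close>. So \<open>v\<close> is twice
    an idempotent; positivity of \<open>a a\<^sup>\<star>\<close> makes it zero, and the injectivity of \<open>1 - u\<^sup>2\<close> expresses
    the part of positivity that is needed.\<close>
  define v where "v = a * a - a * a\<^sup>\<star>"
  define u where "u = (1 / 2) *\<^sub>R (a - a\<^sup>\<star>)"
  have skew: "u\<^sup>\<star> = - u"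
    by (simp add: u_def star_scaleR star_diff star_star scaleR_minus_right[symmetric])
  have "(a - a\<^sup>\<star>) * (a - a\<^sup>\<star>) = 2 *\<^sub>R v"
    by (simp add: v_def algebra_simps comm aa scaleR_2)
  then have uu: "u * u = (1 / 2) *\<^sub>R v" by (simp add: u_def)
  have vv: "v * v = 2 *\<^sub>R v"
  proof -
    have 1: "(a * a) * (a * a) = a * a" by (simp add: mult.assoc aaa)
    have 2: "(a * a) * (a * a\<^sup>\<star>) = a * a\<^sup>\<star>" by (metis aaa mult.assoc)
    have 3: "(a * a\<^sup>\<star>) * (a * a) = a * a\<^sup>\<star>" by (metis aaa comm mult.assoc)
    have 4: "(a * a\<^sup>\<star>) * (a * a\<^sup>\<star>) = a * a" by (metis 1 aa comm mult.assoc)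
    have "v * v = (a * a) * (a * a) - (a * a) * (a * a\<^sup>\<star>)
        - (a * a\<^sup>\<star>) * (a * a) + (a * a\<^sup>\<star>) * (a * a\<^sup>\<star>)"
      unfolding v_def by (simp only: left_diff_distrib right_diff_distrib) simp
    then show ?thesis unfolding 1 2 3 4 by (simp add: v_def scaleR_2)
  qed
  have "(u * u) * (u * u) = u * u" by (simp add: uu vv)
  then have "(u * u) - u * (u * (u * u)) = 0" by (simp add: mult.assoc)
  then have "u * u = 0" by (rule skew_resolvent_square_inj[OF skew])
  then have "u\<^sup>\<star> * u = 0" by (simp add: skew)
  then have "u = 0" by (simp add: star_mult_self_eq_zero_iff)
  then show ?thesis by (simp add: u_def hermitian_def)
qed

theorem theorem5p4:
  fixes a :: "'a::cstar_algebra"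
  shows "normal a \<and> mp_hermitian a \<longleftrightarrow> hermitian a \<and> partial_isometry a"
proof
  assume a: "normal a \<and> mp_hermitian a"
  then have "hermitian a" using normal_mp_hermitian_imp_hermitian by blast
  with a show "hermitian a \<and> partial_isometry a"
    by (simp add: hermitian_def mp_hermitian_def partial_isometry_def)
next
  assume "hermitian a \<and> partial_isometry a"
  then show "normal a \<and> mp_hermitian a"
    by (simp add: hermitian_def mp_hermitian_def partial_isometry_def normal_def)
qed

end
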